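(* The scaled CRPS, defined by $$\mathrm{SCRPS}(\mathbb{P},y) := -\frac{\mathsf{E}_{\mathbb{P}}[|X-y|]}{\mathsf{E}_{\mathbb{P},\mathbb{P}}[|X-Y|]} - \frac12\log\left(\mathsf{E}_{\mathbb{P},\mathbb{P}}[|X-Y|]\right),$$ is a proper scoring rule on the class $\mathcal{P}_1$ of (non-degenerate) Borel probability measures $\mathbb{P}$ on $\mathbb{R}$ with $\mathsf{E}_{\mathbb{P}}[|X|]<\infty$.
   Context: $\mathsf{E}_{\mathbb{P}}[g(X)]$ is the expectation for $X\sim\mathbb{P}$, and $\mathsf{E}_{\mathbb{P},\mathbb{P}}[g(X,Y)]$ is the expectation for independent $X,Y\sim\mathbb{P}$. For a scoring rule $S(\mathbb{P},y)$, write $S(\mathbb{P},\mathbb{Q})$ for the expected value of $S(\mathbb{P},Y)$ when $Y\sim\mathbb{Q}$. $S$ is proper on a class $\mathcal{P}$ of probability measures if $S(\mathbb{Q},\mathbb{Q})\ge S(\mathbb{P},\mathbb{Q})$ for all $\mathbb{P},\mathbb{Q}\in\mathcal{P}$. Non-degenerate means not a point mass, i.e. $\mathsf{E}_{\mathbb{P},\mathbb{P}}[|X-Y|]>0$. *)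

theory Defs
  imports "HOL-Probability.Probability"
begin

definition expected_score :: "('a measure \<Rightarrow> 'a \<Rightarrow> real) \<Rightarrow> 'a measure \<Rightarrow> 'a measure \<Rightarrow> real" where
  "expected_score S P Q = (\<integral>y. S P y \<partial>Q)"

text \<open>
  The Bochner integral is total, with value 0 on non-integrable functions. The following
  predicate says that all expected scores over the class are genuine finite expectations.
\<close>

definition scoring_rule_on :: "'a measure set \<Rightarrow> ('a measure \<Rightarrow> 'a \<Rightarrow> real) \<Rightarrow> bool" where
  "scoring_rule_on \<P> S \<longleftrightarrow> (\<forall>P\<in>\<P>. \<forall>Q\<in>\<P>. integrable Q (S P))"

definition proper_scoring_rule_on :: "'a measure set \<Rightarrow> ('a measure \<Rightarrow> 'a \<Rightarrow> real) \<Rightarrow> bool" where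
  "proper_scoring_rule_on \<P> S \<longleftrightarrow>
     scoring_rule_on \<P> S \<and>
     (\<forall>P\<in>\<P>. \<forall>Q\<in>\<P>. expected_score S Q Q \<ge> expected_score S P Q)"

text \<open>
  \<open>mean_abs_diff P\<close> is the expectation of \<open>\<bar>X - Y\<bar>\<close> for independent \<open>X\<close> and \<open>Y\<close> with law \<open>P\<close>:
  independence is encoded by the product measure.
\<close>

definition mean_abs_diff :: "real measure \<Rightarrow> real" where
  "mean_abs_diff P = (\<integral>(x, y). \<bar>x - y\<bar> \<partial>(P \<Otimes>\<^sub>M P))"

definition SCRPS :: "real measure \<Rightarrow> real \<Rightarrow> real" where
  "SCRPS P y =
     - ((\<integral>x. \<bar>x - y\<bar> \<partial>P) / mean_abs_diff P) - 1 / 2 * ln (mean_abs_diff P)"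

text \<open>
  For a Borel probability measure with finite first moment this amounts to \<open>mean_abs_diff P > 0\<close>.
\<close>

definition nondegenerate :: "real measure \<Rightarrow> bool" where
  "nondegenerate P \<longleftrightarrow> (\<nexists>a. P = return borel a)"

definition P1 :: "real measure set" where
  "P1 = {P. prob_space P \<and> sets P = sets borel \<and> nondegenerate P \<and> integrable P (\<lambda>x. \<bar>x\<bar>)}"

end

theory Submission imports Defs
begin

text \<open>
  Write \<open>D(P, Q)\<close> for the expectation of \<open>\<bar>X - Y\<bar>\<close> with independent \<open>X \<sim> P\<close> and \<open>Y \<sim> Q\<close>, and
  \<open>F\<close>, \<open>G\<close> for the distribution functions of \<open>P\<close> and \<open>Q\<close>. Propriety rests on two inequalities.

  The first is the energy inequality \<open>D(P, P) + D(Q, Q) \<le> 2 D(P, Q)\<close>. A level \<open>t\<close> separates \<open>x\<close>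
  from \<open>y\<close> exactly when it lies between them, so \<open>\<bar>x - y\<bar>\<close> is the Lebesgue measure of the
  separating levels, and by Tonelli
  \<open>D(P, Q) = \<integral> F (1 - G) + G (1 - F) dt\<close> (lemma \<open>nn_integral_abs_diff_eq\<close>). The energy inequality
  then holds level by level, since the integrands differ by \<open>2 (F - G)\<^sup>2\<close>.

  The second is \<open>ln u \<le> u - 1\<close>. The expected score of \<open>P\<close> under \<open>Q\<close> is
  \<open>- D(P, Q) / D(P, P) - ln (D(P, P)) / 2\<close>. Bounding \<open>D(P, Q)\<close> from below by the energy inequality
  leaves an expression that depends only on \<open>D(P, P)\<close> and \<open>D(Q, Q)\<close>, and the inequality for the
  logarithm at \<open>u = D(Q, Q) / D(P, P)\<close> bounds it by \<open>- 1 - ln (D(Q, Q)) / 2\<close>, the expected score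
  of \<open>Q\<close> under itself. Dividing by \<open>D(P, P)\<close> is legitimate because that number vanishes only for
  point masses (lemma \<open>mean_abs_diff_pos\<close>).
\<close>

lemma emeasure_lborel_separating_levels:
  "(\<integral>\<^sup>+t. indicator {..t} x * indicator {t<..} y + indicator {..t} y * indicator {t<..} x \<partial>lborel)
     = ennreal \<bar>x - y\<bar>" for x y :: real
proof -
  have "(\<integral>\<^sup>+t. indicator {..t} x * indicator {t<..} y + indicator {..t} y * indicator {t<..} x \<partial>lborel)
      = (\<integral>\<^sup>+t. indicator {min x y..<max x y} t \<partial>lborel)"
    by (intro nn_integral_cong) (auto simp: indicator_def)
  also have "\<dots> = ennreal \<bar>x - y\<bar>"
    by (auto simp: min_def max_def)
  finally show ?thesis .
qed

lemma borel_measurable_indicator_ray [measurable]: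
  fixes f g :: "'a \<Rightarrow> real"
  assumes [measurable]: "f \<in> borel_measurable M" "g \<in> borel_measurable M"
  shows "(\<lambda>x. indicator {..g x} (f x) :: ennreal) \<in> borel_measurable M"
    and "(\<lambda>x. indicator {g x<..} (f x) :: ennreal) \<in> borel_measurable M"
  by (simp_all add: indicator_def)

text \<open>
  This is \<open>D(P, Q) = \<integral> F (1 - G) + G (1 - F) dt\<close>, with the tails of the two measures in place of
  \<open>1 - F\<close> and \<open>1 - G\<close>: the levels are integrated last instead of first.
\<close>

lemma nn_integral_abs_diff_eq:
  fixes P Q :: "real measure"
  assumes "sigma_finite_measure P" "sigma_finite_measure Q"
    and sP [measurable_cong]: "sets P = sets borel" and sQ [measurable_cong]: "sets Q = sets borel"
  shows "(\<integral>\<^sup>+x. \<integral>\<^sup>+y. ennreal \<bar>x - y\<bar> \<partial>Q \<partial>P)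
    = (\<integral>\<^sup>+t. emeasure P {..t} * emeasure Q {t<..} + emeasure Q {..t} * emeasure P {t<..} \<partial>lborel)"
proof -
  interpret P: sigma_finite_measure P by fact
  interpret Q: sigma_finite_measure Q by fact
  interpret QL: pair_sigma_finite Q lborel ..
  interpret PL: pair_sigma_finite P lborel ..
  let ?f = "\<lambda>x y t. indicator {..t} x * indicator {t<..} y
                   + indicator {..t} y * indicator {t<..} x :: ennreal"
  have "(\<integral>\<^sup>+x. \<integral>\<^sup>+y. ennreal \<bar>x - y\<bar> \<partial>Q \<partial>P) = (\<integral>\<^sup>+x. \<integral>\<^sup>+y. \<integral>\<^sup>+t. ?f x y t \<partial>lborel \<partial>Q \<partial>P)"
    by (simp add: emeasure_lborel_separating_levels)
  also have "\<dots> = (\<integral>\<^sup>+x. \<integral>\<^sup>+t. \<integral>\<^sup>+y. ?f x y t \<partial>Q \<partial>lborel \<partial>P)"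
    by (intro nn_integral_cong QL.Fubini'[symmetric]) measurable
  also have "\<dots> = (\<integral>\<^sup>+t. \<integral>\<^sup>+x. \<integral>\<^sup>+y. ?f x y t \<partial>Q \<partial>P \<partial>lborel)"
    by (intro PL.Fubini'[symmetric]) measurable
  also have "\<dots> = (\<integral>\<^sup>+t. emeasure P {..t} * emeasure Q {t<..}
                      + emeasure Q {..t} * emeasure P {t<..} \<partial>lborel)"
    by (intro nn_integral_cong)
      (simp add: nn_integral_add nn_integral_cmult nn_integral_multc sP sQ)
  finally show ?thesis .
qed

text \<open>
  The distribution functions enter at each level as \<open>a = F t\<close> and \<open>b = G t\<close>; the two sides below
  differ by \<open>2 (a - b)\<^sup>2\<close>.
\<close>

lemma energy_inequality_at_level:
  fixes P Q :: "real measure"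
  assumes "prob_space P" "prob_space Q" and sP: "sets P = sets borel" and sQ: "sets Q = sets borel"
  shows "2 * (emeasure P {..t} * emeasure P {t<..}) + 2 * (emeasure Q {..t} * emeasure Q {t<..})
    \<le> 2 * (emeasure P {..t} * emeasure Q {t<..} + emeasure Q {..t} * emeasure P {t<..})"
proof -
  interpret P: prob_space P by fact
  interpret Q: prob_space Q by fact
  have tail: "measure M {t<..} = 1 - measure M {..t}"
    if "prob_space M" "sets M = sets borel" for M :: "real measure"
  proof -
    have "{t<..} = space M - {..t}"
      using sets_eq_imp_space_eq[OF that(2)] by auto
    then show ?thesis
      using prob_space.prob_compl[OF that(1), of "{..t}"] that(2) by simp
  qed
  define a b where "a = measure P {..t}" and "b = measure Q {..t}"
  have ab: "0 \<le> a" "a \<le> 1" "0 \<le> b" "b \<le> 1"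
    by (auto simp: a_def b_def)
  have e: "emeasure P {..t} = ennreal a" "emeasure P {t<..} = ennreal (1 - a)"
    "emeasure Q {..t} = ennreal b" "emeasure Q {t<..} = ennreal (1 - b)"
    using tail[OF assms(1) sP] tail[OF assms(2) sQ]
    by (auto simp: P.emeasure_eq_measure Q.emeasure_eq_measure a_def b_def)
  have "2 * (a * (1 - a)) + 2 * (b * (1 - b)) \<le> 2 * (a * (1 - b) + b * (1 - a))"
    using zero_le_power2[of "a - b"] by (simp add: power2_eq_square algebra_simps)
  then have "ennreal (2 * (a * (1 - a)) + 2 * (b * (1 - b))) \<le> ennreal (2 * (a * (1 - b) + b * (1 - a)))"
    by (rule ennreal_leI)
  with ab show ?thesis
    by (simp add: e ennreal_mult ennreal_plus)
qed

lemma nn_integral_energy_inequality: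
  fixes P Q :: "real measure"
  assumes P: "prob_space P" and Q: "prob_space Q"
    and sP [measurable_cong]: "sets P = sets borel" and sQ [measurable_cong]: "sets Q = sets borel"
  shows "(\<integral>\<^sup>+x. \<integral>\<^sup>+y. ennreal \<bar>x - y\<bar> \<partial>P \<partial>P) + (\<integral>\<^sup>+x. \<integral>\<^sup>+y. ennreal \<bar>x - y\<bar> \<partial>Q \<partial>Q)
    \<le> 2 * (\<integral>\<^sup>+x. \<integral>\<^sup>+y. ennreal \<bar>x - y\<bar> \<partial>Q \<partial>P)"
proof -
  interpret P: prob_space P by fact
  interpret Q: prob_space Q by fact
  have [measurable]: "(\<lambda>t. emeasure M {..t}) \<in> borel_measurable borel"
    "(\<lambda>t. emeasure M {t<..}) \<in> borel_measurable borel"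
    if "prob_space M" and [measurable_cong]: "sets M = sets borel" for M :: "real measure"
  proof -
    interpret M: prob_space M by fact
    have "(\<lambda>t. \<integral>\<^sup>+x. indicator {..t} x \<partial>M) \<in> borel_measurable borel"
      "(\<lambda>t. \<integral>\<^sup>+x. indicator {t<..} x \<partial>M) \<in> borel_measurable borel"
      by measurable
    then show "(\<lambda>t. emeasure M {..t}) \<in> borel_measurable borel"
      "(\<lambda>t. emeasure M {t<..}) \<in> borel_measurable borel"
      by (simp_all add: that)
  qed
  note [measurable] = this[OF P sP] this[OF Q sQ]
  note eq = nn_integral_abs_diff_eq[OF P.sigma_finite_measure_axioms P.sigma_finite_measure_axioms sP sP]
    nn_integral_abs_diff_eq[OF Q.sigma_finite_measure_axioms Q.sigma_finite_measure_axioms sQ sQ]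
    nn_integral_abs_diff_eq[OF P.sigma_finite_measure_axioms Q.sigma_finite_measure_axioms sP sQ]
  show ?thesis
    unfolding eq mult_2[symmetric]
    by (subst nn_integral_add[symmetric], measurable, subst nn_integral_cmult[symmetric], measurable,
        intro nn_integral_mono energy_inequality_at_level[OF P Q sP sQ])
qed

lemma integrable_pair_abs_diff:
  fixes P Q :: "real measure"
  assumes "prob_space P" "prob_space Q"
    and [measurable_cong]: "sets P = sets borel" "sets Q = sets borel"
    and iP: "integrable P (\<lambda>x. \<bar>x\<bar>)" and iQ: "integrable Q (\<lambda>x. \<bar>x\<bar>)"
  shows "integrable (P \<Otimes>\<^sub>M Q) (\<lambda>(x, y). \<bar>x - y\<bar>)"
proof -
  interpret P: prob_space P by fact
  interpret Q: prob_space Q by fact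
  interpret PQ: pair_sigma_finite P Q ..
  have "integrable (P \<Otimes>\<^sub>M Q) (\<lambda>z. \<bar>fst z\<bar>)"
    by (rule PQ.Fubini_integrable) (auto simp: iP)
  moreover have "integrable (P \<Otimes>\<^sub>M Q) (\<lambda>z. \<bar>snd z\<bar>)"
    by (rule PQ.Fubini_integrable) (auto simp: iQ)
  ultimately have "integrable (P \<Otimes>\<^sub>M Q) (\<lambda>z. \<bar>fst z\<bar> + \<bar>snd z\<bar>)"
    by (rule Bochner_Integration.integrable_add)
  then show ?thesis
    by (rule Bochner_Integration.integrable_bound) (auto simp: split_beta)
qed

text \<open>
  With first moments finite, all three terms are real numbers and the inequality transfers to
  Bochner integrals.
\<close>

lemma energy_inequality:
  fixes P Q :: "real measure"
  assumes P: "prob_space P" and Q: "prob_space Q"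
    and sP: "sets P = sets borel" and sQ: "sets Q = sets borel"
    and iP: "integrable P (\<lambda>x. \<bar>x\<bar>)" and iQ: "integrable Q (\<lambda>x. \<bar>x\<bar>)"
  shows "mean_abs_diff P + mean_abs_diff Q \<le> 2 * (\<integral>(x, y). \<bar>x - y\<bar> \<partial>(P \<Otimes>\<^sub>M Q))"
proof -
  have eq: "(\<integral>\<^sup>+x. \<integral>\<^sup>+y. ennreal \<bar>x - y\<bar> \<partial>N \<partial>M) = ennreal (\<integral>(x, y). \<bar>x - y\<bar> \<partial>(M \<Otimes>\<^sub>M N))"
    if M: "prob_space M" and N: "prob_space N"
      and sM [measurable_cong]: "sets M = sets borel" and sN [measurable_cong]: "sets N = sets borel"
      and iM: "integrable M (\<lambda>x. \<bar>x\<bar>)" and iN: "integrable N (\<lambda>x. \<bar>x\<bar>)"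
    for M N :: "real measure"
  proof -
    interpret N: prob_space N by fact
    have "(\<integral>\<^sup>+x. \<integral>\<^sup>+y. ennreal \<bar>x - y\<bar> \<partial>N \<partial>M) = (\<integral>\<^sup>+z. ennreal (case z of (x, y) \<Rightarrow> \<bar>x - y\<bar>) \<partial>(M \<Otimes>\<^sub>M N))"
      by (subst N.nn_integral_fst[symmetric]) auto
    also have "\<dots> = ennreal (\<integral>(x, y). \<bar>x - y\<bar> \<partial>(M \<Otimes>\<^sub>M N))"
      by (rule nn_integral_eq_integral[OF integrable_pair_abs_diff[OF that]]) auto
    finally show ?thesis .
  qed
  have nonneg: "0 \<le> (\<integral>(x, y). \<bar>x - y\<bar> \<partial>(M \<Otimes>\<^sub>M N))" for M N :: "real measure"
    by (rule Bochner_Integration.integral_nonneg) auto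
  have "ennreal (mean_abs_diff P + mean_abs_diff Q) \<le> ennreal (2 * (\<integral>(x, y). \<bar>x - y\<bar> \<partial>(P \<Otimes>\<^sub>M Q)))"
    using nn_integral_energy_inequality[OF P Q sP sQ]
    unfolding eq[OF P P sP sP iP iP] eq[OF Q Q sQ sQ iQ iQ] eq[OF P Q sP sQ iP iQ] mean_abs_diff_def
    by (simp add: ennreal_mult ennreal_plus nonneg)
  then show ?thesis
    using nonneg by (subst (asm) ennreal_le_iff) auto
qed

lemma AE_eq_const_imp_return:
  fixes P :: "real measure"
  assumes "prob_space P" and s: "sets P = sets borel" and ae: "AE y in P. y = a"
  shows "P = return borel a"
proof (rule measure_eqI)
  interpret prob_space P by fact
  show "sets P = sets (return borel a)" by (simp add: s)
  fix A assume A: "A \<in> sets P"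
  have "emeasure P A = (\<integral>\<^sup>+y. indicator A y \<partial>P)" using A by simp
  also have "\<dots> = (\<integral>\<^sup>+y. indicator A a \<partial>P)"
    by (rule nn_integral_cong_AE) (use ae in auto)
  also have "\<dots> = indicator A a" by (simp add: emeasure_space_1)
  finally show "emeasure P A = emeasure (return borel a) A"
    using A by (simp add: s)
qed

text \<open>
  If \<open>\<bar>X - Y\<bar>\<close> vanishes almost surely for independent copies, then by Fubini some fixed value of \<open>X\<close>
  equals \<open>Y\<close> almost surely, which makes the law a point mass.
\<close>

lemma mean_abs_diff_pos:
  assumes "P \<in> P1"
  shows "0 < mean_abs_diff P"
proof (rule ccontr)
  assume "\<not> 0 < mean_abs_diff P"
  moreover have "0 \<le> mean_abs_diff P"
    unfolding mean_abs_diff_def by (rule Bochner_Integration.integral_nonneg) auto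
  ultimately have zero: "(\<integral>(x, y). \<bar>x - y\<bar> \<partial>(P \<Otimes>\<^sub>M P)) = 0"
    by (simp add: mean_abs_diff_def)
  have P: "prob_space P" and s: "sets P = sets borel" and i: "integrable P (\<lambda>x. \<bar>x\<bar>)"
    and nd: "nondegenerate P"
    using assms by (auto simp: P1_def)
  interpret P: prob_space P by fact
  interpret PP: pair_sigma_finite P P ..
  have "AE z in P \<Otimes>\<^sub>M P. (case z of (x, y) \<Rightarrow> \<bar>x - y\<bar>) = 0"
    using integral_nonneg_eq_0_iff_AE[OF integrable_pair_abs_diff[OF P P s s i i]] zero
    by (simp add: split_beta)
  then have "AE x in P. AE y in P. (case (x, y) of (x, y) \<Rightarrow> \<bar>x - y\<bar>) = 0"
    by (rule PP.AE_pair)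
  then obtain x where "AE y in P. \<bar>x - y\<bar> = 0"
    using eventually_happens'[OF P.ae_filter_bot] by auto
  then have "AE y in P. y = x"
    by eventually_elim simp
  from AE_eq_const_imp_return[OF P s this] nd show False
    by (auto simp: nondegenerate_def)
qed

theorem corollary2: "proper_scoring_rule_on P1 SCRPS"
  unfolding proper_scoring_rule_on_def scoring_rule_on_def
proof (intro conjI ballI)
  have score: "integrable Q (SCRPS P) \<and> expected_score SCRPS P Q
      = - ((\<integral>(x, y). \<bar>x - y\<bar> \<partial>(P \<Otimes>\<^sub>M Q)) / mean_abs_diff P) - 1 / 2 * ln (mean_abs_diff P)"
    if PQ: "P \<in> P1" "Q \<in> P1" for P Q
  proof -
    have P: "prob_space P" and Q: "prob_space Q"
      and sP: "sets P = sets borel" and sQ: "sets Q = sets borel"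
      and iP: "integrable P (\<lambda>x. \<bar>x\<bar>)" and iQ: "integrable Q (\<lambda>x. \<bar>x\<bar>)"
      using PQ by (auto simp: P1_def)
    interpret P: prob_space P by fact
    interpret Q: prob_space Q by fact
    interpret PQ: pair_sigma_finite P Q ..
    note i = integrable_pair_abs_diff[OF P Q sP sQ iP iQ]
    have int: "integrable Q (\<lambda>y. \<integral>x. \<bar>x - y\<bar> \<partial>P)"
      using PQ.integrable_snd[OF i] .
    have "(\<integral>y. (\<integral>x. \<bar>x - y\<bar> \<partial>P) \<partial>Q) = (\<integral>(x, y). \<bar>x - y\<bar> \<partial>(P \<Otimes>\<^sub>M Q))"
      using PQ.integral_snd[OF i] .
    with int show ?thesis
      by (simp add: expected_score_def SCRPS_def[abs_def] Q.prob_space)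
  qed
  fix P Q assume PQ: "P \<in> P1" "Q \<in> P1"
  show "integrable Q (SCRPS P)" using score[OF PQ] by simp
  define a b c where "a = mean_abs_diff P" and "b = mean_abs_diff Q"
    and "c = (\<integral>(x, y). \<bar>x - y\<bar> \<partial>(P \<Otimes>\<^sub>M Q))"
  have pos: "0 < a" "0 < b"
    using PQ by (auto simp: a_def b_def mean_abs_diff_pos)
  have "a + b \<le> 2 * c"
    unfolding a_def b_def c_def by (rule energy_inequality) (use PQ in \<open>auto simp: P1_def\<close>)
  then have "1 + b / a \<le> 2 * (c / a)"
    using pos divide_right_mono[of "a + b" "2 * c" a] by (simp add: add_divide_distrib)
  moreover have "ln b - ln a \<le> b / a - 1"
    using ln_le_minus_one[of "b / a"] pos by (simp add: ln_div)
  ultimately have "- (c / a) - 1 / 2 * ln a \<le> - 1 - 1 / 2 * ln b"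
    by simp
  moreover have "expected_score SCRPS Q Q = - 1 - 1 / 2 * ln b"
    using score[of Q Q] PQ pos by (simp add: b_def mean_abs_diff_def)
  moreover have "expected_score SCRPS P Q = - (c / a) - 1 / 2 * ln a"
    using score[OF PQ] by (simp add: a_def c_def)
  ultimately show "expected_score SCRPS P Q \<le> expected_score SCRPS Q Q" by simp
qed

end
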